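(* Let $M$ be a Euclidean $R$-module over a ring $R$ and let $M_1\subseteq M_2$ be nonzero submodules of $M$. Then $M_1=M_2$ if and only if $g(M_1)=g(M_2)$.
   Context: Rings are unital and modules are left modules. A poset is Artinian if every descending chain in it stabilizes. An $R$-module $M$ is a Euclidean module if there is a function $d_M:M\setminus\{0\}\to P$ to a poset $(P,\ge)$ such that the poset $\mathrm{im}(d_M)$ is Artinian and, for any nonzero $u,v\in M$, there are $q\in R$ and $r\in M$ with $u=qv+r$ and either $r=0$ or $d_M(r)<d_M(v)$. For a nonzero submodule $N\subseteq M$: $g(N):=\min\{d_M(x):0\neq x\in N\}$ (the least value; it is presupposed to exist). *)

theory Defs
  imports "HOL-Algebra.Module"
begin

text \<open>
  The library's locale \<open>module\<close> requires a commutative base ring. This is the same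
  list of axioms over an arbitrary unital ring; the records and the library predicate
  \<open>submodule\<close> (which does not refer to commutativity) are reused.
\<close>

locale left_module = R?: ring + M?: abelian_group M for M (structure) +
  assumes smult_closed:
      "\<lbrakk>a \<in> carrier R; x \<in> carrier M\<rbrakk> \<Longrightarrow> a \<odot>\<^bsub>M\<^esub> x \<in> carrier M"
    and smult_l_distr:
      "\<lbrakk>a \<in> carrier R; b \<in> carrier R; x \<in> carrier M\<rbrakk> \<Longrightarrow>
        (a \<oplus> b) \<odot>\<^bsub>M\<^esub> x = a \<odot>\<^bsub>M\<^esub> x \<oplus>\<^bsub>M\<^esub> b \<odot>\<^bsub>M\<^esub> x"
    and smult_r_distr:
      "\<lbrakk>a \<in> carrier R; x \<in> carrier M; y \<in> carrier M\<rbrakk> \<Longrightarrow>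
        a \<odot>\<^bsub>M\<^esub> (x \<oplus>\<^bsub>M\<^esub> y) = a \<odot>\<^bsub>M\<^esub> x \<oplus>\<^bsub>M\<^esub> a \<odot>\<^bsub>M\<^esub> y"
    and smult_assoc1:
      "\<lbrakk>a \<in> carrier R; b \<in> carrier R; x \<in> carrier M\<rbrakk> \<Longrightarrow>
        (a \<otimes> b) \<odot>\<^bsub>M\<^esub> x = a \<odot>\<^bsub>M\<^esub> (b \<odot>\<^bsub>M\<^esub> x)"
    and smult_one:
      "x \<in> carrier M \<Longrightarrow> \<one> \<odot>\<^bsub>M\<^esub> x = x"

definition artinian_poset :: "'p::order set \<Rightarrow> bool" where
  "artinian_poset A \<longleftrightarrow>
     (\<forall>c :: nat \<Rightarrow> 'p. range c \<subseteq> A \<and> antimono c \<longrightarrow> (\<exists>n. \<forall>m\<ge>n. c m = c n))"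

text \<open>
  A Euclidean module together with a chosen Euclidean function \<open>d\<close>. As \<open>d\<close> is
  meaningful on nonzero elements only, its value at zero and outside the carrier
  is never used. The codomain is an arbitrary, not necessarily linear, order.
\<close>

locale euclidean_module = left_module R M
  for R :: "('a, 'r) ring_scheme" and M :: "('a, 'b, 'm) module_scheme" +
  fixes d :: "'b \<Rightarrow> 'p::order"
  assumes artinian_image: "artinian_poset (d ` (carrier M - {\<zero>\<^bsub>M\<^esub>}))"
    and division:
      "\<lbrakk>u \<in> carrier M; u \<noteq> \<zero>\<^bsub>M\<^esub>; v \<in> carrier M; v \<noteq> \<zero>\<^bsub>M\<^esub>\<rbrakk> \<Longrightarrow>
        \<exists>q\<in>carrier R. \<exists>r\<in>carrier M. u = q \<odot>\<^bsub>M\<^esub> v \<oplus>\<^bsub>M\<^esub> r \<and> (r = \<zero>\<^bsub>M\<^esub> \<or> d r < d v)"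

text \<open>
  The least value of \<open>d\<close> on the nonzero elements of \<open>N\<close>. Since the order is only
  partial, such a value need not exist, even for an Artinian image; \<open>least_norm\<close>
  is meaningful only under \<open>has_least_norm\<close>.
\<close>

definition has_least_norm ::
    "('a, 'b, 'm) module_scheme \<Rightarrow> ('b \<Rightarrow> 'p::order) \<Rightarrow> 'b set \<Rightarrow> bool" where
  "has_least_norm M d N \<longleftrightarrow>
     (\<exists>x \<in> N - {\<zero>\<^bsub>M\<^esub>}. \<forall>y \<in> N - {\<zero>\<^bsub>M\<^esub>}. d x \<le> d y)"

definition least_norm ::
    "('a, 'b, 'm) module_scheme \<Rightarrow> ('b \<Rightarrow> 'p::order) \<Rightarrow> 'b set \<Rightarrow> 'p" where
  "least_norm M d N = (LEAST p. p \<in> d ` (N - {\<zero>\<^bsub>M\<^esub>}))"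

end

theory Submission
  imports Defs
begin

text \<open>Equal submodules trivially have equal minima. Conversely, suppose the minima agree and
  let \<open>v\<close> in \<open>M1\<close> attain the common value; then \<open>v\<close> is also
  minimal among the nonzero elements of \<open>M2\<close>. Dividing a nonzero u in \<open>M2\<close>
  by \<open>v\<close> leaves a remainder in \<open>M2\<close>
  (\<open>submodule_remainder_closed\<close>), which minimality forces to be zero. So u is a
  multiple of \<open>v\<close> and lies in \<open>M1\<close>.\<close>

text \<open>\<open>LEAST\<close> is a mere description until a least element is exhibited; the
  hypothesis supplies one, so the value is attained and is a lower bound.\<close>

lemma has_least_normE:
  assumes "has_least_norm M d N"
  obtains x where "x \<in> N" "x \<noteq> \<zero>\<^bsub>M\<^esub>" "d x = least_norm M d N"
    "\<And>y. y \<in> N \<Longrightarrow> y \<noteq> \<zero>\<^bsub>M\<^esub> \<Longrightarrow> least_norm M d N \<le> d y"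
proof -
  obtain x where x: "x \<in> N" "x \<noteq> \<zero>\<^bsub>M\<^esub>" "\<And>y. y \<in> N \<Longrightarrow> y \<noteq> \<zero>\<^bsub>M\<^esub> \<Longrightarrow> d x \<le> d y"
    using assms unfolding has_least_norm_def by auto
  have "least_norm M d N = d x"
    unfolding least_norm_def by (rule Least_equality) (use x in auto)
  with x that show thesis by auto
qed

context left_module
begin

text \<open>The remainder is the difference of u and qv, both in \<open>N\<close>. This keeps the
  remainder of a division inside the submodule.\<close>

lemma submodule_remainder_closed:
  assumes N: "submodule N R M" and "q \<in> carrier R" "r \<in> carrier M" "v \<in> N"
    and u: "q \<odot>\<^bsub>M\<^esub> v \<oplus>\<^bsub>M\<^esub> r \<in> N"
  shows "r \<in> N"
proof -
  have sg: "subgroup N (add_monoid M)"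
    using N by (simp add: submodule_def)
  have qv: "q \<odot>\<^bsub>M\<^esub> v \<in> N"
    using N assms by (simp add: submodule_def submodule_axioms_def)
  then have c: "q \<odot>\<^bsub>M\<^esub> v \<in> carrier M"
    using subgroup.mem_carrier[OF sg] by simp
  have "\<ominus>\<^bsub>M\<^esub> (q \<odot>\<^bsub>M\<^esub> v) \<oplus>\<^bsub>M\<^esub> (q \<odot>\<^bsub>M\<^esub> v \<oplus>\<^bsub>M\<^esub> r) \<in> N"
    using subgroup.m_closed[OF sg subgroup.m_inv_closed[OF sg qv] u]
    by (simp add: a_inv_def)
  then show ?thesis
    using c assms(3) by (simp add: M.r_neg1)
qed

end

theorem lemma2p6:
  fixes R :: "('a, 'r) ring_scheme"
    and M :: "('a, 'b, 'm) module_scheme"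
    and d :: "'b \<Rightarrow> 'p::order"
    and M1 M2 :: "'b set"
  assumes "euclidean_module R M d"
    and "submodule M1 R M" and "M1 \<noteq> {\<zero>\<^bsub>M\<^esub>}"
    and "submodule M2 R M" and "M2 \<noteq> {\<zero>\<^bsub>M\<^esub>}"
    and "M1 \<subseteq> M2"
    and "has_least_norm M d M1" and "has_least_norm M d M2"
  shows "M1 = M2 \<longleftrightarrow> least_norm M d M1 = least_norm M d M2"
proof
  assume eq: "least_norm M d M1 = least_norm M d M2"
  interpret euclidean_module R M d by fact
  have sg1: "subgroup M1 (add_monoid M)" and sg2: "subgroup M2 (add_monoid M)"
    using assms(2,4) by (simp_all add: submodule_def)
  \<comment> \<open>The equality of minima enters here: \<open>v\<close> is taken from the smaller
    submodule but realizes the minimum of the larger one.\<close>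
  obtain v where v: "v \<in> M1" "v \<noteq> \<zero>\<^bsub>M\<^esub>" "d v = least_norm M d M2"
    using has_least_normE[OF assms(7)] eq by metis
  have vmin: "d v \<le> d y" if "y \<in> M2" "y \<noteq> \<zero>\<^bsub>M\<^esub>" for y
    using has_least_normE[OF assms(8)] that v(3) by metis
  have "u \<in> M1" if u: "u \<in> M2" for u
  \<comment> \<open>Division is available for nonzero dividends only, so zero is treated
    apart.\<close>
  proof (cases "u = \<zero>\<^bsub>M\<^esub>")
    case True
    then show ?thesis using subgroup.one_closed[OF sg1] by simp
  next
    case False
    have carr: "u \<in> carrier M" "v \<in> carrier M"
      using subgroup.mem_carrier[OF sg2] u v(1) \<open>M1 \<subseteq> M2\<close> by auto
    obtain q r where qr: "q \<in> carrier R" "r \<in> carrier M" "u = q \<odot>\<^bsub>M\<^esub> v \<oplus>\<^bsub>M\<^esub> r"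
      "r = \<zero>\<^bsub>M\<^esub> \<or> d r < d v"
      using division[OF carr(1) False carr(2) v(2)] by blast
    have "r \<in> M2"
      using submodule_remainder_closed[OF assms(4) qr(1,2)] u v(1) qr(3) \<open>M1 \<subseteq> M2\<close> by blast
    \<comment> \<open>A nonzero \<open>r\<close> would satisfy both \<open>d r < d v\<close> and
      \<open>d v \<le> d r\<close>.\<close>
    with qr(4) vmin have "r = \<zero>\<^bsub>M\<^esub>"
      using leD by blast
    then have "u = q \<odot>\<^bsub>M\<^esub> v"
      using qr carr by (simp add: smult_closed)
    then show ?thesis
      using assms(2) qr(1) v(1) by (simp add: submodule_def submodule_axioms_def)
  qed
  with \<open>M1 \<subseteq> M2\<close> show "M1 = M2" by blast
qed simp

end
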